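(* Let $p\in(1/2,1)$ be fixed. For all sufficiently large $n$ (depending on $p$) there exists a 2D $p$-bounded RC encoder with exactly one redundant bit, that is, a map $\mathrm{Enc}:\{0,1\}^{n^2-1}\to\{0,1\}^{n\times n}$ with $\mathrm{Enc}(x)\in\mathrm{B}_{\mathrm{RC}}(n;p)$ for all $x\in\{0,1\}^{n^2-1}$ together with a map $\mathrm{Dec}:\{0,1\}^{n\times n}\to\{0,1\}^{n^2-1}$ satisfying $\mathrm{Dec}(\mathrm{Enc}(x))=x$ for all $x\in\{0,1\}^{n^2-1}$.
   Context: The weight of a binary sequence is its number of ones. A binary sequence of length $m$ is $p$-bounded if its weight is at most $pm$. $\mathrm{B}_{\mathrm{RC}}(n;p)$ is the set of all $n\times n$ binary arrays in which every row and every column is $p$-bounded. The redundancy of an encoder $\{0,1\}^k\to\{0,1\}^{n\times n}$ is $n^2-k$. *)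

theory Defs
  imports Complex_Main "HOL-Library.FuncSet"
begin

text \<open>
  The alphabet \<open>{0,1}\<close> is \<^typ>\<open>bool\<close>, with \<^const>\<open>True\<close> for the symbol \<open>1\<close>.
  An \<open>n \<times> n\<close> array is the list of its \<open>n\<close> rows.
\<close>

definition binary_seqs :: "nat \<Rightarrow> bool list set" where
  "binary_seqs m = {xs. length xs = m}"

definition binary_arrays :: "nat \<Rightarrow> bool list list set" where
  "binary_arrays n = {A. length A = n \<and> (\<forall>r\<in>set A. r \<in> binary_seqs n)}"

definition weight :: "bool list \<Rightarrow> nat" where
  "weight xs = count_list xs True"

definition p_bounded :: "real \<Rightarrow> bool list \<Rightarrow> bool" where
  "p_bounded p xs \<longleftrightarrow> real (weight xs) \<le> p * real (length xs)"

definition row :: "bool list list \<Rightarrow> nat \<Rightarrow> bool list" where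
  "row A i = A ! i"

definition column :: "bool list list \<Rightarrow> nat \<Rightarrow> bool list" where
  "column A j = map (\<lambda>r. r ! j) A"

definition B_RC :: "nat \<Rightarrow> real \<Rightarrow> bool list list set" where
  "B_RC n p = {A \<in> binary_arrays n.
     (\<forall>i<n. p_bounded p (row A i)) \<and> (\<forall>j<n. p_bounded p (column A j))}"

text \<open>The redundancy of such an encoder is \<open>n\<^sup>2 - k\<close>.\<close>

definition RC_encoder ::
  "nat \<Rightarrow> real \<Rightarrow> nat \<Rightarrow> (bool list \<Rightarrow> bool list list) \<Rightarrow> (bool list list \<Rightarrow> bool list) \<Rightarrow> bool" where
  "RC_encoder n p k Enc Dec \<longleftrightarrow>
     Enc \<in> binary_seqs k \<rightarrow> B_RC n p \<and>
     Dec \<in> binary_arrays n \<rightarrow> binary_seqs k \<and>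
     (\<forall>x\<in>binary_seqs k. Dec (Enc x) = x)"

end

theory Submission
  imports Defs
begin

text \<open>
  By the Chernoff bound, a uniformly random row or column of an \<open>n \<times> n\<close> array violates the
  weight constraint with probability at most \<open>q ^ n\<close> for some \<open>q < 1\<close>. A union bound over the
  \<open>2 * n\<close> lines shows that for large \<open>n\<close> at least half of all arrays are admissible, and any
  injection of the \<open>2 ^ (n\<^sup>2 - 1)\<close> messages into the admissible arrays is an encoder.
\<close>

lemma binary_seqs_0: "binary_seqs 0 = {[]}"
  by (auto simp: binary_seqs_def)

lemma binary_seqs_Suc:
  "binary_seqs (Suc m) = Cons True ` binary_seqs m \<union> Cons False ` binary_seqs m"
  by (auto simp: binary_seqs_def length_Suc_conv)

lemma finite_binary_seqs [simp]: "finite (binary_seqs m)"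
  by (induction m) (auto simp: binary_seqs_0 binary_seqs_Suc)

text \<open>This is the weight enumerator: each symbol independently contributes a factor
  \<open>t\<close> or \<open>1\<close>. At \<open>t = 1\<close> it counts all sequences; for real
  \<open>t\<close> it supplies the exponential moment in the Chernoff bound.\<close>

lemma sum_power_weight:
  fixes t :: "'a :: comm_semiring_1"
  shows "(\<Sum>xs\<in>binary_seqs m. t ^ weight xs) = (1 + t) ^ m"
proof (induction m)
  case 0
  show ?case by (simp add: binary_seqs_0 weight_def)
next
  case (Suc m)
  have "(\<Sum>xs\<in>binary_seqs (Suc m). t ^ weight xs) =
      (\<Sum>xs\<in>Cons True ` binary_seqs m. t ^ weight xs) +
      (\<Sum>xs\<in>Cons False ` binary_seqs m. t ^ weight xs)"
    unfolding binary_seqs_Suc by (rule sum.union_disjoint) auto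
  also have "\<dots> = t * (\<Sum>xs\<in>binary_seqs m. t ^ weight xs) + (\<Sum>xs\<in>binary_seqs m. t ^ weight xs)"
    by (simp add: sum.reindex weight_def sum_distrib_left)
  finally show ?case
    by (simp add: Suc.IH algebra_simps)
qed

lemma card_binary_seqs: "card (binary_seqs m) = 2 ^ m"
  using sum_power_weight[of "1 :: nat" m] by (simp add: numeral_2_eq_2)

text \<open>Markov's inequality in exponential form: since \<open>t\<close> is at least 1, every
  violating sequence has \<open>t ^ weight xs\<close> at least \<open>(t powr p) ^ m\<close>, while
  the sum over all sequences is only \<open>(1 + t) ^ m\<close>.\<close>

lemma card_not_p_bounded_le:
  fixes p t :: real
  assumes "1 \<le> t"
  shows "real (card {xs \<in> binary_seqs m. \<not> p_bounded p xs}) \<le> ((1 + t) / t powr p) ^ m"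
proof -
  let ?B = "{xs \<in> binary_seqs m. \<not> p_bounded p xs}"
  have "real (card ?B) * (t powr p) ^ m = (\<Sum>xs\<in>?B. (t powr p) ^ m)"
    by simp
  also have "\<dots> \<le> (\<Sum>xs\<in>?B. t ^ weight xs)"
  proof (rule sum_mono)
    fix xs assume "xs \<in> ?B"
    then have "p * real m \<le> real (weight xs)"
      by (auto simp: p_bounded_def binary_seqs_def)
    then have "t powr (p * real m) \<le> t powr real (weight xs)"
      using assms by (intro powr_mono)
    then show "(t powr p) ^ m \<le> t ^ weight xs"
      using assms by (simp add: powr_realpow powr_power mult.commute)
  qed
  also have "\<dots> \<le> (\<Sum>xs\<in>binary_seqs m. t ^ weight xs)"
    using assms by (intro sum_mono2) auto
  also have "\<dots> = (1 + t) ^ m"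
    by (rule sum_power_weight)
  finally show ?thesis
    using assms by (simp add: power_divide pos_le_divide_eq)
qed

text \<open>Makes the base \<open>(1 + t) / t powr p\<close> of the Chernoff bound smaller than 2.
  Both sides equal 1 at \<open>t = 1\<close>, where the right one has slope \<open>p\<close> and the
  left one only \<open>1 / 2\<close>, so the right one is ahead just after 1.\<close>

lemma exists_chernoff_parameter:
  fixes p :: real
  assumes "1 / 2 < p"
  shows "\<exists>t>1. (1 + t) / 2 < t powr p"
proof -
  let ?g = "\<lambda>t::real. t powr p - (1 + t) / 2"
  have "(?g has_real_derivative (p - 1 / 2)) (at 1)"
    by (auto intro!: derivative_eq_intros)
  then obtain d where "d > 0" and d: "\<And>h. 0 < h \<Longrightarrow> h < d \<Longrightarrow> ?g 1 < ?g (1 + h)"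
    using DERIV_pos_inc_right[of ?g "p - 1 / 2" 1] assms by auto
  \<comment> \<open>Here \<open>?g 1\<close> is 0, and \<open>d / 2\<close> is just some step
    strictly between 0 and \<open>d\<close>.\<close>
  have "?g 1 < ?g (1 + d / 2)"
    using \<open>d > 0\<close> by (intro d) auto
  then show ?thesis
    using \<open>d > 0\<close> by (intro exI[of _ "1 + d / 2"]) auto
qed

lemma binary_arrays_altdef: "binary_arrays n = {A. set A \<subseteq> binary_seqs n \<and> length A = n}"
  by (auto simp: binary_arrays_def)

lemma finite_binary_arrays [simp]: "finite (binary_arrays n)"
  by (simp add: binary_arrays_altdef finite_lists_length_eq)

lemma card_binary_arrays: "card (binary_arrays n) = 2 ^ n\<^sup>2"
  by (simp add: binary_arrays_altdef card_lists_length_eq card_binary_seqs power2_eq_square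
      flip: power_mult)

text \<open>A list is determined by its entry at \<open>i\<close> together with the list left after
  deleting that entry. The former lies in \<open>S \<inter> R\<close>, and the other
  \<open>n - 1\<close> entries range freely over \<open>S\<close>.\<close>

lemma card_lists_nth_in_le:
  assumes "finite S" "i < n"
  shows "card {xs. set xs \<subseteq> S \<and> length xs = n \<and> xs ! i \<in> R} \<le> card (S \<inter> R) * card S ^ (n - 1)"
proof -
  let ?X = "{xs. set xs \<subseteq> S \<and> length xs = n \<and> xs ! i \<in> R}"
  let ?Y = "(S \<inter> R) \<times> {xs. set xs \<subseteq> S \<and> length xs = n - 1}"
  let ?f = "\<lambda>xs. (xs ! i, take i xs @ drop (Suc i) xs)"
  have "inj_on ?f ?X"
  proof (rule inj_onI)
    fix xs ys assume xs: "xs \<in> ?X" and ys: "ys \<in> ?X" and eq: "?f xs = ?f ys"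
    have "take i xs = take i ys" "drop (Suc i) xs = drop (Suc i) ys"
      using xs ys eq assms by (simp_all add: append_eq_append_conv)
    moreover have "xs = take i xs @ xs ! i # drop (Suc i) xs" "ys = take i ys @ ys ! i # drop (Suc i) ys"
      using xs ys assms by (simp_all add: id_take_nth_drop)
    ultimately show "xs = ys"
      using eq by (metis prod.inject)
  qed
  moreover have "?f ` ?X \<subseteq> ?Y"
    using assms by (auto dest!: subsetD[OF set_take_subset] subsetD[OF set_drop_subset])
  moreover have "finite ?Y"
    using assms by (simp add: finite_lists_length_eq)
  ultimately have "card ?X \<le> card ?Y"
    by (rule card_inj_on_le)
  then show ?thesis
    using assms by (simp add: card_cartesian_product card_lists_length_eq)
qed

lemma card_bad_row_le:
  assumes "i < n"
  shows "card {A \<in> binary_arrays n. \<not> p_bounded p (row A i)}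
    \<le> card {xs \<in> binary_seqs n. \<not> p_bounded p xs} * 2 ^ (n * (n - 1))"
proof -
  have "{A \<in> binary_arrays n. \<not> p_bounded p (row A i)} =
      {A. set A \<subseteq> binary_seqs n \<and> length A = n \<and> A ! i \<in> {xs. \<not> p_bounded p xs}}"
    by (auto simp: binary_arrays_altdef row_def)
  moreover have "binary_seqs n \<inter> {xs. \<not> p_bounded p xs} = {xs \<in> binary_seqs n. \<not> p_bounded p xs}"
    by auto
  ultimately show ?thesis
    using card_lists_nth_in_le[OF finite_binary_seqs assms, of n "{xs. \<not> p_bounded p xs}"]
    by (simp add: card_binary_seqs power_mult)
qed

text \<open>Transposition is injective on arrays and turns column \<open>j\<close> into row
  \<open>j\<close>, so the row count also bounds the column count.\<close>

lemma card_bad_column_le: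
  assumes "j < n"
  shows "card {A \<in> binary_arrays n. \<not> p_bounded p (column A j)}
    \<le> card {A \<in> binary_arrays n. \<not> p_bounded p (row A j)}"
proof -
  let ?T = "\<lambda>A. map (column A) [0..<n]"
  have nth: "?T A ! k ! i = A ! i ! k" if "A \<in> binary_arrays n" "i < n" "k < n" for A i k
    using that by (simp add: column_def binary_arrays_def)
  have "inj_on ?T (binary_arrays n)"
  proof (rule inj_onI)
    fix A B assume A: "A \<in> binary_arrays n" and B: "B \<in> binary_arrays n" and eq: "?T A = ?T B"
    have "A ! i ! k = B ! i ! k" if "i < n" "k < n" for i k
      using nth[OF A that] nth[OF B that] eq by simp
    then show "A = B"
      using A B by (auto simp: binary_arrays_def binary_seqs_def list_eq_iff_nth_eq)
  qed
  then have "inj_on ?T {A \<in> binary_arrays n. \<not> p_bounded p (column A j)}"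
    by (rule inj_on_subset) auto
  moreover have "?T ` {A \<in> binary_arrays n. \<not> p_bounded p (column A j)}
      \<subseteq> {A \<in> binary_arrays n. \<not> p_bounded p (row A j)}"
    using assms by (auto simp: binary_arrays_def binary_seqs_def row_def column_def)
  ultimately show ?thesis
    by (rule card_inj_on_le) simp
qed

lemma card_not_B_RC_le:
  "card (binary_arrays n - B_RC n p)
    \<le> 2 * n * (card {xs \<in> binary_seqs n. \<not> p_bounded p xs} * 2 ^ (n * (n - 1)))"
proof -
  let ?R = "\<lambda>i. {A \<in> binary_arrays n. \<not> p_bounded p (row A i)}"
  let ?C = "\<lambda>j. {A \<in> binary_arrays n. \<not> p_bounded p (column A j)}"
  let ?b = "card {xs \<in> binary_seqs n. \<not> p_bounded p xs} * 2 ^ (n * (n - 1))"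
  have R: "card (\<Union>i<n. ?R i) \<le> n * ?b"
    using card_UN_le[of "{..<n}" ?R] sum_bounded_above[of "{..<n}" "\<lambda>i. card (?R i)" ?b]
      card_bad_row_le by fastforce
  have C: "card (\<Union>j<n. ?C j) \<le> n * ?b"
    using card_UN_le[of "{..<n}" ?C] sum_bounded_above[of "{..<n}" "\<lambda>j. card (?C j)" ?b]
      order_trans[OF card_bad_column_le card_bad_row_le] by fastforce
  have "binary_arrays n - B_RC n p = (\<Union>i<n. ?R i) \<union> (\<Union>j<n. ?C j)"
    by (auto simp: B_RC_def)
  then have "card (binary_arrays n - B_RC n p) \<le> card (\<Union>i<n. ?R i) + card (\<Union>j<n. ?C j)"
    by (simp add: card_Un_le)
  then show ?thesis
    using R C by simp
qed

lemma exists_RC_encoder: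
  assumes "2 ^ k \<le> card (B_RC n p)"
  shows "\<exists>Enc Dec. RC_encoder n p k Enc Dec"
proof -
  have "finite (B_RC n p)"
    by (simp add: B_RC_def)
  then obtain Enc where Enc: "Enc ` binary_seqs k \<subseteq> B_RC n p" "inj_on Enc (binary_seqs k)"
    using card_le_inj[of "binary_seqs k" "B_RC n p"] assms by (auto simp: card_binary_seqs)
  \<comment> \<open>A decoder must return a message of length \<open>k\<close> on every array, so
    arrays outside the image of \<open>Enc\<close> get the all-zero message.\<close>
  define Dec where "Dec A = (if A \<in> Enc ` binary_seqs k
    then the_inv_into (binary_seqs k) Enc A else replicate k False)" for A
  have "Dec A \<in> binary_seqs k" for A
    using Enc(2) the_inv_into_into[OF Enc(2), of A "binary_seqs k"]
    by (auto simp: Dec_def binary_seqs_def)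
  moreover have "Dec (Enc x) = x" if "x \<in> binary_seqs k" for x
    using that Enc(2) by (simp add: Dec_def the_inv_into_f_f)
  ultimately have "RC_encoder n p k Enc Dec"
    using Enc(1) by (auto simp: RC_encoder_def)
  then show ?thesis by blast
qed

theorem mainTheorem5:
  fixes p :: real
  assumes "1 / 2 < p" and "p < 1"
  shows "\<exists>N. \<forall>n\<ge>N. \<exists>Enc Dec. RC_encoder n p (n\<^sup>2 - 1) Enc Dec"
proof -
  obtain t :: real where t: "t > 1" "(1 + t) / 2 < t powr p"
    using exists_chernoff_parameter[OF assms(1)] by blast
  define r where "r = (1 + t) / t powr p"
  \<comment> \<open>After division by the \<open>2 ^ n\<close> sequences of length \<open>n\<close>,
    the Chernoff bound \<open>r ^ n\<close> becomes the probability bound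
    \<open>q ^ n\<close>.\<close>
  define q where "q = r / 2"
  have "0 \<le> r" "r < 2"
    using t by (simp_all add: r_def pos_divide_less_eq)
  then have q: "0 \<le> q" "q < 1" "r = 2 * q"
    by (auto simp: q_def)
  have "(\<lambda>n. real n * q ^ n) \<longlonglongrightarrow> 0"
    using q by (intro powser_times_n_limit_0) simp
  \<comment> \<open>The union bound over \<open>2 * n\<close> lines gives a bad fraction of at most
    \<open>2 * n * q ^ n\<close>; the threshold \<open>1 / 4\<close> keeps it below one
    half.\<close>
  then have "eventually (\<lambda>n. real n * q ^ n < 1 / 4) sequentially"
    by (rule order_tendstoD) simp
  then obtain N where N: "\<And>n. n \<ge> N \<Longrightarrow> real n * q ^ n < 1 / 4"
    by (auto simp: eventually_sequentially)
  \<comment> \<open>Taking \<open>n\<close> at least 1 keeps the natural-number subtraction in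
    \<open>n\<^sup>2 - 1\<close> from truncating.\<close>
  have "\<exists>Enc Dec. RC_encoder n p (n\<^sup>2 - 1) Enc Dec" if n: "n \<ge> max N 1" for n
  proof (rule exists_RC_encoder)
    have "real (card {xs \<in> binary_seqs n. \<not> p_bounded p xs}) \<le> 2 ^ n * q ^ n"
      using card_not_p_bounded_le[of t n p, folded r_def] t q(3) by (simp add: power_mult_distrib)
    then have "real (card (binary_arrays n - B_RC n p))
        \<le> 2 * real n * ((2 ^ n * q ^ n) * 2 ^ (n * (n - 1)))"
      using card_not_B_RC_le[of n p, THEN of_nat_mono[where 'a = real]]
      by (simp, elim order_trans, intro mult_left_mono mult_right_mono, auto)
    also have "\<dots> = 2 * (real n * q ^ n) * 2 ^ (n + n * (n - 1))"
      by (simp add: power_add)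
    \<comment> \<open>The exponent is \<open>n\<^sup>2\<close>, written as a successor so that the
      extra factor 2 cancels the fraction one half.\<close>
    also have "n + n * (n - 1) = Suc (n\<^sup>2 - 1)"
      using n by (cases n) (auto simp: power2_eq_square)
    also have "2 * (real n * q ^ n) * 2 ^ Suc (n\<^sup>2 - 1) \<le> 2 * (1 / 4) * 2 ^ Suc (n\<^sup>2 - 1)"
      using N[of n] n by (intro mult_right_mono mult_left_mono) auto
    also have "\<dots> = real (2 ^ (n\<^sup>2 - 1))"
      by simp
    finally have "card (binary_arrays n - B_RC n p) \<le> 2 ^ (n\<^sup>2 - 1)"
      by (simp only: of_nat_le_iff)
    moreover have "card (binary_arrays n - B_RC n p) = 2 ^ n\<^sup>2 - card (B_RC n p)"
      by (subst card_Diff_subset) (auto simp: card_binary_arrays B_RC_def)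
    moreover have "(2 :: nat) ^ n\<^sup>2 = 2 * 2 ^ (n\<^sup>2 - 1)"
      using n by (simp flip: power_Suc)
    ultimately show "2 ^ (n\<^sup>2 - 1) \<le> card (B_RC n p)"
      by linarith
  qed
  then show ?thesis by blast
qed

end
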